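(* Let $q\in\mathbb{C}$ with $0<|q|<1$. For all $z\in\mathbb{C}$, $$(-z;q)_{\infty}=\sum_{n=0}^{\infty}\frac{q^{2n^{2}-n}z^{2n}}{(q^{2};q^{2})_{n}}A_{q}\left(-q^{2n-1}z\right).$$
   Context: Notation: for a base $p$ with $|p|<1$, $(a;p)_\infty=\prod_{k\ge0}(1-ap^k)$ and $(a;p)_n=\prod_{k=0}^{n-1}(1-ap^k)$. The Ramanujan function is $A_q(x)=\sum_{n=0}^\infty \frac{q^{n^2}}{(q;q)_n}(-x)^n$. *)

theory Defs
  imports "HOL-Analysis.Analysis"
begin

definition qpoch :: "complex \<Rightarrow> complex \<Rightarrow> nat \<Rightarrow> complex" where
  "qpoch a p n = (\<Prod>k<n. 1 - a * p ^ k)"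

definition qpoch_inf :: "complex \<Rightarrow> complex \<Rightarrow> complex" where
  "qpoch_inf a p = (\<Prod>k. 1 - a * p ^ k)"

definition ramanujan_A :: "complex \<Rightarrow> complex \<Rightarrow> complex" where
  "ramanujan_A q x = (\<Sum>n. q ^ (n\<^sup>2) / qpoch q q n * (- x) ^ n)"

text \<open>The infinite product and the series above converge for a base inside the unit disc, so
  the totalised operators take their usual values. Vanishing factors are harmless:
  the library's notion of a convergent product allows finitely many of them.\<close>

lemma convergent_prod_qpoch:
  fixes a p :: complex
  assumes "norm p < 1"
  shows "convergent_prod (\<lambda>k. 1 - a * p ^ k)"
proof -
  have "summable (\<lambda>k. norm a * norm p ^ k)"
    using assms by (intro summable_mult summable_geometric) auto
  moreover have "norm ((1 - a * p ^ k) - 1) = norm a * norm p ^ k" for k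
    by (simp add: norm_mult norm_power)
  ultimately have "summable (\<lambda>k. norm ((1 - a * p ^ k) - 1))"
    by presburger
  then have "abs_convergent_prod (\<lambda>k. 1 - a * p ^ k)"
    by (simp only: summable_imp_abs_convergent_prod)
  then show ?thesis
    by (rule abs_convergent_prod_imp_convergent_prod)
qed

lemma summable_ramanujan_A:
  assumes "norm q < 1"
  shows "summable (\<lambda>n. q ^ (n\<^sup>2) / qpoch q q n * (- x) ^ n)"
proof -
  have "(\<lambda>n. norm q * norm x * (norm q ^ n) ^ 2 / (1 - norm q)) \<longlonglongrightarrow> norm q * norm x * 0 ^ 2 / (1 - norm q)"
    using assms by (intro tendsto_intros LIMSEQ_power_zero) auto
  then have "\<forall>\<^sub>F n in sequentially. norm q * norm x * (norm q ^ n) ^ 2 / (1 - norm q) < 1 / 2"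
    by (rule order_tendstoD) simp
  then obtain N where N: "\<And>n. n \<ge> N \<Longrightarrow> norm q * norm x * (norm q ^ n) ^ 2 / (1 - norm q) < 1 / 2"
    by (auto simp: eventually_sequentially)
  show ?thesis
  proof (rule summable_ratio_test[of "1 / 2" N])
    fix n assume "N \<le> n"
    define t where "t = q ^ (n\<^sup>2) / qpoch q q n * (- x) ^ n"
    have step: "q ^ ((Suc n)\<^sup>2) / qpoch q q (Suc n) * (- x) ^ Suc n
        = t * (q * (q ^ n) ^ 2 * (- x) / (1 - q * q ^ n))"
    proof -
      have "q ^ ((Suc n)\<^sup>2) = q ^ (n\<^sup>2) * (q * (q ^ n) ^ 2)"
        by (simp add: power2_eq_square power_add)
      then show ?thesis
        by (simp add: t_def qpoch_def)
    qed
    have "norm (q * q ^ n) \<le> norm q"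
      using assms by (simp add: norm_mult norm_power mult_left_le power_le_one)
    then have den: "1 - norm q \<le> norm (1 - q * q ^ n)"
      using norm_triangle_ineq2[of 1 "q * q ^ n"] by simp
    have "norm (q * (q ^ n) ^ 2 * (- x) / (1 - q * q ^ n))
        = norm q * norm x * (norm q ^ n) ^ 2 / norm (1 - q * q ^ n)"
      by (simp add: norm_divide norm_mult norm_power)
    also have "\<dots> \<le> norm q * norm x * (norm q ^ n) ^ 2 / (1 - norm q)"
      using den assms by (intro divide_left_mono mult_pos_pos) auto
    also have "\<dots> \<le> 1 / 2"
      using N[OF \<open>N \<le> n\<close>] by simp
    finally have le: "norm (q * (q ^ n) ^ 2 * (- x) / (1 - q * q ^ n)) \<le> 1 / 2" .
    have "norm (t * (q * (q ^ n) ^ 2 * (- x) / (1 - q * q ^ n))) \<le> 1 / 2 * norm t"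
      using mult_right_mono[OF le norm_ge_zero[of t]] by (simp only: norm_mult mult.commute)
    then show "norm (q ^ ((Suc n)\<^sup>2) / qpoch q q (Suc n) * (- x) ^ Suc n)
        \<le> 1 / 2 * norm (q ^ (n\<^sup>2) / qpoch q q n * (- x) ^ n)"
      unfolding step t_def .
  qed simp
qed

end

theory Submission
  imports Defs
begin

text \<open>
  The identity is the change of the order of summation in a double series. Since
  \<open>A\<^sub>q(-q\<^bsup>2n-1\<^esup>z)\<close> is itself a power series in \<open>z\<close> with summation index \<open>m\<close>, the right-hand
  side is a sum over pairs \<open>(n, m)\<close>, and \<open>z\<close> occurs in it to the power \<open>k = 2n + m\<close>.
  The exponent of \<open>q\<close> splits as
  \<open>2n\<^sup>2 - n + m\<^sup>2 + (2n - 1)m = binom(k, 2) + binom(m, 2)\<close>,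
  so that the coefficient of \<open>z\<^sup>k\<close> is \<open>q\<^bsup>binom(k, 2)\<^esup>\<close> times
  the sum of \<open>q\<^bsup>binom(m, 2)\<^esup> / ((q;q)\<^sub>m (q\<^sup>2;q\<^sup>2)\<^sub>n)\<close> over \<open>m + 2n = k\<close>.

  That last sum equals \<open>1 / (q;q)\<^sub>k\<close> (\<open>euler_coeff_convolution\<close>). It is the coefficient of
  \<open>x\<^sup>k\<close> in \<open>(-x;q)\<^sub>\<infinity> / (x\<^sup>2;q\<^sup>2)\<^sub>\<infinity>\<close>, by Euler's expansions of a \<open>q\<close>-product and of its
  reciprocal, and the quotient is \<open>1 / (x;q)\<^sub>\<infinity>\<close> because
  \<open>(x;q)\<^sub>\<infinity> (-x;q)\<^sub>\<infinity> = (x\<^sup>2;q\<^sup>2)\<^sub>\<infinity>\<close>. Hence the double series is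
  the sum of \<open>q\<^bsup>binom(k, 2)\<^esup> z\<^sup>k / (q;q)\<^sub>k\<close>, which is Euler's expansion of
  \<open>(-z;q)\<^sub>\<infinity>\<close> (\<open>euler_series_sums\<close>). The rearrangement is legitimate because the double
  series converges absolutely (\<open>double_term_summable\<close>): it is dominated by the product of two
  Euler series, with bases \<open>q\<close> and \<open>q\<^sup>2\<close>.
\<close>

section \<open>Euler's expansion of the infinite product\<close>

lemma qpoch_0 [simp]: "qpoch a p 0 = 1"
  by (simp add: qpoch_def)

lemma qpoch_Suc: "qpoch a p (Suc n) = qpoch a p n * (1 - a * p ^ n)"
  by (simp add: qpoch_def)

lemma one_minus_power_Suc_nonzero:
  fixes q :: complex
  assumes "norm q < 1"
  shows "1 - q * q ^ n \<noteq> 0"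
proof
  assume "1 - q * q ^ n = 0"
  then have "norm q ^ Suc n = 1"
    by (metis eq_iff_diff_eq_0 norm_one norm_power power_Suc)
  moreover have "norm q ^ Suc n < 1"
    using assms power_decreasing[of 1 "Suc n" "norm q"] by simp
  ultimately show False
    by simp
qed

lemma qpoch_self_nonzero: "norm q < 1 \<Longrightarrow> qpoch q q n \<noteq> 0"
  using one_minus_power_Suc_nonzero[of q] by (induction n) (auto simp: qpoch_Suc)

lemma Suc_choose_two: "Suc n choose 2 = (n choose 2) + n"
  by (simp add: numeral_2_eq_2)

definition euler_coeff :: "complex \<Rightarrow> nat \<Rightarrow> complex" where
  "euler_coeff q n = q ^ (n choose 2) / qpoch q q n"

lemma euler_coeff_0 [simp]: "euler_coeff q 0 = 1"
  by (simp add: euler_coeff_def binomial_eq_0)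

lemma euler_coeff_Suc:
  "euler_coeff q (Suc n) = euler_coeff q n * (q ^ n / (1 - q * q ^ n))"
  by (simp add: euler_coeff_def qpoch_Suc Suc_choose_two power_add)

text \<open>
  This is the functional equation \<open>G(z) = (1 + z) G(qz)\<close> of the generating function \<open>G\<close>, read
  off coefficient by coefficient. It is used twice: for the convergent series in \<open>z\<close> and for a
  formal power series.
\<close>
lemma euler_coeff_recurrence:
  assumes "norm q < 1"
  shows "euler_coeff q (Suc n) = q ^ Suc n * euler_coeff q (Suc n) + q ^ n * euler_coeff q n"
  using one_minus_power_Suc_nonzero[OF assms, of n]
  by (simp add: euler_coeff_Suc field_simps)

text \<open>
  The ratio of successive terms is \<open>q\<^sup>n z / (1 - q\<^bsup>n+1\<^esup>)\<close>, which tends to \<open>0\<close>; so there is no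
  restriction on \<open>z\<close>.
\<close>
lemma norm_summable_euler:
  fixes q z :: complex
  assumes "norm q < 1"
  shows "summable (\<lambda>n. norm (euler_coeff q n * z ^ n))"
proof -
  have "(\<lambda>n. norm (q ^ n / (1 - q * q ^ n) * z)) \<longlonglongrightarrow> norm (0 / (1 - q * 0) * z)"
    using assms by (intro tendsto_intros LIMSEQ_power_zero) auto
  then have "\<forall>\<^sub>F n in sequentially. norm (q ^ n / (1 - q * q ^ n) * z) < 1 / 2"
    by (rule order_tendstoD) simp
  then obtain N where N: "\<And>n. n \<ge> N \<Longrightarrow> norm (q ^ n / (1 - q * q ^ n) * z) < 1 / 2"
    by (auto simp: eventually_sequentially)
  show ?thesis
  proof (rule summable_ratio_test[of "1 / 2" N])
    fix n assume "N \<le> n"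
    have "euler_coeff q (Suc n) * z ^ Suc n
        = (q ^ n / (1 - q * q ^ n) * z) * (euler_coeff q n * z ^ n)"
      by (simp add: euler_coeff_Suc)
    then have "norm (euler_coeff q (Suc n) * z ^ Suc n)
        = norm (q ^ n / (1 - q * q ^ n) * z) * norm (euler_coeff q n * z ^ n)"
      by (simp only: norm_mult)
    also have "\<dots> \<le> 1 / 2 * norm (euler_coeff q n * z ^ n)"
      using N[OF \<open>N \<le> n\<close>] by (intro mult_right_mono) auto
    finally show "norm (norm (euler_coeff q (Suc n) * z ^ Suc n))
        \<le> 1 / 2 * norm (norm (euler_coeff q n * z ^ n))"
      by simp
  qed simp
qed

lemma summable_euler: "norm q < 1 \<Longrightarrow> summable (\<lambda>n. euler_coeff q n * z ^ n)"
  by (rule summable_norm_cancel[OF norm_summable_euler])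

lemma euler_series_functional_equation:
  fixes q z :: complex
  assumes q: "norm q < 1"
  defines "G \<equiv> \<lambda>z. \<Sum>n. euler_coeff q n * z ^ n"
  shows "G z = (1 + z) * G (q * z)"
proof -
  have s: "(\<lambda>n. euler_coeff q n * w ^ n) sums G w" for w
    unfolding G_def using summable_euler[OF q] by (rule summable_sums)
  have tail: "(\<lambda>n. euler_coeff q (Suc n) * w ^ Suc n) sums (G w - 1)" for w
    using s[of w] by (subst sums_Suc_iff) simp
  have "(\<lambda>n. euler_coeff q (Suc n) * (q * z) ^ Suc n + z * (euler_coeff q n * (q * z) ^ n))
      sums (G (q * z) - 1 + z * G (q * z))"
    by (intro sums_add tail sums_mult s)
  moreover have "euler_coeff q (Suc n) * (q * z) ^ Suc n + z * (euler_coeff q n * (q * z) ^ n)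
      = euler_coeff q (Suc n) * z ^ Suc n" for n
  proof -
    have "euler_coeff q (Suc n) * (q * z) ^ Suc n + z * (euler_coeff q n * (q * z) ^ n)
        = (q ^ Suc n * euler_coeff q (Suc n) + q ^ n * euler_coeff q n) * z ^ Suc n"
      by (simp add: power_mult_distrib algebra_simps)
    then show ?thesis
      by (simp only: euler_coeff_recurrence[OF q, symmetric])
  qed
  ultimately have "G z - 1 = G (q * z) - 1 + z * G (q * z)"
    using tail[of z] by (simp add: sums_unique2)
  then show ?thesis
    by (simp add: algebra_simps)
qed

text \<open>
  Iterating the functional equation gives \<open>G(z) = (-z;q)\<^sub>N G(q\<^sup>N z)\<close>. As \<open>N\<close> grows, the first
  factor tends to the infinite product, and the second to \<open>G(0) = 1\<close> because a power series is
  continuous.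
\<close>
lemma euler_series_sums:
  fixes q z :: complex
  assumes q: "norm q < 1"
  shows "(\<lambda>n. euler_coeff q n * z ^ n) sums qpoch_inf (- z) q"
proof -
  define G where "G = (\<lambda>z. \<Sum>n. euler_coeff q n * z ^ n)"
  have G_step: "G w = (1 + w) * G (q * w)" for w
    unfolding G_def by (rule euler_series_functional_equation[OF q])
  have iterate: "G z = qpoch (- z) q N * G (q ^ N * z)" for N
  proof (induction N)
    case (Suc N)
    have "G (q ^ N * z) = (1 + q ^ N * z) * G (q ^ Suc N * z)"
      using G_step[of "q ^ N * z"] by (simp add: mult.assoc)
    with Suc show ?case
      by (simp add: qpoch_Suc mult_ac)
  qed simp
  have "isCont G 0"
    unfolding G_def using summable_euler[OF q] by (rule isCont_powser_converges_everywhere)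
  moreover have "(\<lambda>N. q ^ N * z) \<longlonglongrightarrow> 0"
    using q by (auto intro!: tendsto_eq_intros LIMSEQ_power_zero)
  ultimately have G_lim: "(\<lambda>N. G (q ^ N * z)) \<longlonglongrightarrow> G 0"
    by (rule isCont_tendsto_compose)
  have G_0: "G 0 = 1"
    by (simp add: G_def powser_zero)
  have "(\<lambda>N. qpoch (- z) q N) \<longlonglongrightarrow> qpoch_inf (- z) q"
    using convergent_prod_LIMSEQ[OF convergent_prod_qpoch[OF q, of "- z"]]
    unfolding qpoch_def qpoch_inf_def by (simp add: LIMSEQ_lessThan_iff_atMost)
  then have "(\<lambda>N. qpoch (- z) q N * G (q ^ N * z)) \<longlonglongrightarrow> qpoch_inf (- z) q * G 0"
    by (intro tendsto_mult G_lim)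
  then have "G z = qpoch_inf (- z) q"
    by (simp add: iterate[symmetric] G_0 LIMSEQ_const_iff)
  then show ?thesis
    using summable_sums[OF summable_euler[OF q], of z] by (simp add: G_def)
qed

section \<open>The convolution of the two kinds of coefficients\<close>

text \<open>
  The substitution \<open>f(x) \<mapsto> f(qx)\<close>, written on coefficients.
\<close>
definition fps_dilate :: "complex \<Rightarrow> complex fps \<Rightarrow> complex fps" where
  "fps_dilate q f = Abs_fps (\<lambda>n. q ^ n * fps_nth f n)"

lemma fps_dilate_mult: "fps_dilate q (f * g) = fps_dilate q f * fps_dilate q g"
proof (rule fps_ext)
  fix n
  have "q ^ n * (fps_nth f i * fps_nth g (n - i))
      = (q ^ i * fps_nth f i) * (q ^ (n - i) * fps_nth g (n - i))" if "i \<in> {0..n}" for i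
  proof -
    have "q ^ n = q ^ i * q ^ (n - i)"
      using that by (simp flip: power_add)
    then show ?thesis
      by (simp only: mult_ac)
  qed
  then show "fps_nth (fps_dilate q (f * g)) n = fps_nth (fps_dilate q f * fps_dilate q g) n"
    unfolding fps_dilate_def fps_mult_nth fps_nth_Abs_fps sum_distrib_left
    by (intro sum.cong refl)
qed

text \<open>
  The left-hand side is a coefficient of the product of the formal series
  \<open>A(x) = (-x;q)\<^sub>\<infinity>\<close> and \<open>B(x) = 1 / (x\<^sup>2;q\<^sup>2)\<^sub>\<infinity>\<close>. Their functional equations
  \<open>A(x) = (1 + x) A(qx)\<close> and \<open>B(qx) = (1 - x\<^sup>2) B(x)\<close> combine, after cancelling \<open>1 + x\<close>, to
  \<open>(AB)(qx) = (1 - x) (AB)(x)\<close>. On coefficients this is the recurrence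
  \<open>(1 - q\<^bsup>k+1\<^esup>) c\<^bsub>k+1\<^esub> = c\<^sub>k\<close> that \<open>1 / (q;q)\<^sub>k\<close> satisfies.
\<close>
lemma euler_coeff_convolution:
  fixes q :: complex
  assumes q: "norm q < 1"
  shows "(\<Sum>n\<le>k div 2. euler_coeff q (k - 2 * n) / qpoch (q\<^sup>2) (q\<^sup>2) n) = 1 / qpoch q q k"
proof -
  have q2: "norm (q\<^sup>2) < 1"
    using q by (simp add: norm_power power_less_one_iff abs_square_less_1)
  define b where "b n = 1 / qpoch (q\<^sup>2) (q\<^sup>2) n" for n
  define A where "A = Abs_fps (euler_coeff q)"
  define B where "B = Abs_fps (\<lambda>j. if even j then b (j div 2) else 0)"
  have b_Suc: "(1 - (q\<^sup>2) ^ Suc n) * b (Suc n) = b n" for n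
    using one_minus_power_Suc_nonzero[OF q2, of n] by (simp add: b_def qpoch_Suc)
  have A: "A = (1 + fps_X) * fps_dilate q A"
  proof (rule fps_ext)
    fix n
    show "fps_nth A n = fps_nth ((1 + fps_X) * fps_dilate q A) n"
      using euler_coeff_recurrence[OF q, of "n - 1"]
      by (cases n) (simp_all add: A_def fps_dilate_def distrib_right)
  qed
  \<comment> \<open>\<open>B\<close> is a series in \<open>x\<^sup>2\<close>; only its even coefficients are not trivially equal.\<close>
  have B: "fps_dilate q B = (1 - fps_X\<^sup>2) * B"
  proof (rule fps_ext)
    fix j
    show "fps_nth (fps_dilate q B) j = fps_nth ((1 - fps_X\<^sup>2) * B) j"
    proof (cases "even j \<and> j > 0")
      case True
      then obtain n where j: "j = Suc n * 2"
        by (metis dvd_def gr0_conv_Suc mult.commute nat_0_less_mult_iff)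
      have "q ^ j = (q\<^sup>2) ^ Suc n"
        by (simp only: j power_mult mult.commute[of _ 2])
      moreover have "(1 - (q\<^sup>2) ^ Suc n) * b (Suc n) = b n"
        by (rule b_Suc)
      ultimately show ?thesis
        by (simp add: B_def fps_dilate_def left_diff_distrib fps_X_power_mult_nth j algebra_simps)
    next
      case False
      then show ?thesis
        by (auto simp: B_def fps_dilate_def left_diff_distrib fps_X_power_mult_nth)
    qed
  qed
  have "(1 + fps_X) * fps_dilate q (A * B) = (1 + fps_X) * ((1 - fps_X) * (A * B))"
  proof -
    have "(1 + fps_X) * fps_dilate q (A * B) = A * fps_dilate q B"
      by (subst (2) A) (simp add: fps_dilate_mult mult_ac)
    also have "\<dots> = (1 + fps_X) * ((1 - fps_X) * (A * B))"
      by (simp add: B power2_eq_square algebra_simps)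
    finally show ?thesis .
  qed
  moreover have "(1 + fps_X :: complex fps) \<noteq> 0"
    by (metis fps_add_nth fps_X_nth fps_one_nth fps_zero_nth add_0_right zero_neq_one)
  ultimately have AB: "fps_dilate q (A * B) = (1 - fps_X) * (A * B)"
    by simp
  have "fps_nth (A * B) k = 1 / qpoch q q k"
  proof (induction k)
    case 0
    show ?case
      by (simp add: A_def B_def b_def)
  next
    case (Suc k)
    have "q ^ Suc k * fps_nth (A * B) (Suc k) = fps_nth (A * B) (Suc k) - fps_nth (A * B) k"
      using arg_cong[OF AB, of "\<lambda>f. fps_nth f (Suc k)"]
      by (simp add: fps_dilate_def left_diff_distrib)
    then have "(1 - q * q ^ k) * fps_nth (A * B) (Suc k) = 1 / qpoch q q k"
      by (simp add: Suc.IH algebra_simps)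
    then show ?case
      using one_minus_power_Suc_nonzero[OF q, of k] qpoch_self_nonzero[OF q, of k]
      by (simp add: qpoch_Suc field_simps)
  qed
  moreover have "fps_nth (A * B) k = (\<Sum>n\<le>k div 2. euler_coeff q (k - 2 * n) * b n)"
  proof -
    have "fps_nth (A * B) k = (\<Sum>j=0..k. fps_nth B j * fps_nth A (k - j))"
      by (simp only: mult.commute[of A] fps_mult_nth)
    also have "\<dots> = (\<Sum>j\<in>(*) 2 ` {..k div 2}. fps_nth B j * fps_nth A (k - j))"
      by (intro sum.mono_neutral_right) (auto simp: B_def)
    also have "\<dots> = (\<Sum>n\<le>k div 2. euler_coeff q (k - 2 * n) * b n)"
      by (subst sum.reindex) (auto simp: inj_on_def A_def B_def mult.commute)
    finally show ?thesis .
  qed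
  ultimately show ?thesis
    by (simp add: b_def)
qed

section \<open>The double series\<close>

lemma int_choose_two: "2 * int (n choose 2) = int n * (int n - 1)"
  by (induction n) (simp_all add: Suc_choose_two binomial_eq_0 algebra_simps)

text \<open>
  The term of the double series, with the exponent of \<open>q\<close> already split as
  \<open>binom(2n + m, 2) + binom(m, 2)\<close>; the second part is inside \<open>euler_coeff q m\<close>. In this form
  the sum along a diagonal \<open>2n + m = k\<close> is visibly a convolution, and there are no negative
  powers of \<open>q\<close>.
\<close>
definition double_term :: "complex \<Rightarrow> complex \<Rightarrow> nat \<times> nat \<Rightarrow> complex" where
  "double_term q z = (\<lambda>(n, m). q ^ ((2 * n + m) choose 2) * z ^ (2 * n + m)
     * (euler_coeff q m / qpoch (q\<^sup>2) (q\<^sup>2) n))"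

text \<open>
  The right-hand side is a product of a function of \<open>n\<close> and a function of \<open>m\<close>. The bound holds
  because the Euler coefficient with base \<open>q\<^sup>2\<close> needs only the power \<open>2 binom(n, 2)\<close> of \<open>q\<close>,
  which is at most the available \<open>binom(2n + m, 2)\<close>; the surplus \<open>d\<close> costs nothing since
  \<open>\<bar>q\<bar> < 1\<close>.
\<close>
lemma norm_double_term_le:
  assumes q: "norm q < 1"
  shows "norm (double_term q z (n, m))
    \<le> norm (euler_coeff (q\<^sup>2) n * (z\<^sup>2) ^ n) * norm (euler_coeff q m * z ^ m)"
proof -
  have "2 * (n choose 2) \<le> (2 * n + m) choose 2"
  proof -
    have "2 * int (2 * (n choose 2)) + (2 * int n * int n + 4 * int n * int m + int m * (int m - 1))
        = 2 * int ((2 * n + m) choose 2)"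
      using int_choose_two[of n] int_choose_two[of "2 * n + m"] by (simp add: algebra_simps)
    moreover have "0 \<le> int m * (int m - 1)"
      by (cases m) auto
    ultimately show ?thesis
      by (smt (verit) mult_nonneg_nonneg of_nat_0_le_iff of_nat_le_iff)
  qed
  then obtain d where d: "(2 * n + m) choose 2 = d + 2 * (n choose 2)"
    by (metis le_add_diff_inverse2)
  have "double_term q z (n, m)
      = q ^ d * ((euler_coeff (q\<^sup>2) n * (z\<^sup>2) ^ n) * (euler_coeff q m * z ^ m))"
    by (simp add: double_term_def d[unfolded mult.commute[of 2 n]] euler_coeff_def power_add mult_ac
        flip: power_mult)
  moreover have "norm (q ^ d) \<le> 1"
    using q by (simp add: norm_power power_le_one)
  ultimately show ?thesis
    by (simp add: norm_mult mult_left_le_one_le)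
qed

lemma double_term_summable:
  assumes q: "norm q < 1"
  shows "double_term q z summable_on UNIV \<times> UNIV"
proof -
  have q2: "norm (q\<^sup>2) < 1"
    using q by (simp add: norm_power power_less_one_iff abs_square_less_1)
  define f where "f n = norm (euler_coeff (q\<^sup>2) n * (z\<^sup>2) ^ n)" for n
  define g where "g m = norm (euler_coeff q m * z ^ m)" for m
  have f: "f summable_on UNIV" and g: "g summable_on UNIV"
    unfolding f_def g_def
    using norm_summable_euler[OF q2, of "z\<^sup>2"] norm_summable_euler[OF q, of z]
    by (auto intro!: norm_summable_imp_summable_on simp: norm_mult norm_power)
  have "(\<lambda>(n, m). f n * g m) summable_on UNIV \<times> UNIV"
  proof (rule summable_on_SigmaI)
    show "((\<lambda>m. (\<lambda>(n, m). f n * g m) (n, m)) has_sum f n * infsum g UNIV) UNIV" for n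
      using g by (simp add: has_sum_cmult_right)
    show "(\<lambda>n. f n * infsum g UNIV) summable_on UNIV"
      using f by (rule summable_on_cmult_left)
  qed (auto simp: f_def g_def)
  then have "(\<lambda>x. norm (double_term q z x)) summable_on UNIV \<times> UNIV"
    by (rule Infinite_Sum.abs_summable_on_comparison_test')
      (use norm_double_term_le[OF q] in \<open>auto simp: f_def g_def\<close>)
  then show ?thesis
    by (rule abs_summable_summable)
qed

text \<open>
  The exponent \<open>2n - 1\<close> is negative at \<open>n = 0\<close>, so the exponents are compared as integers, and
  this is where \<open>q \<noteq> 0\<close> matters.
\<close>
lemma double_term_eq_ramanujan_term:
  assumes "q \<noteq> 0"
  shows "double_term q z (n, m)
    = q powi (2 * (int n)\<^sup>2 - int n) * z ^ (2 * n) / qpoch (q\<^sup>2) (q\<^sup>2) n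
      * (q ^ (m\<^sup>2) / qpoch q q m * (- (- (q powi (2 * int n - 1) * z))) ^ m)"
proof -
  have exponent: "int ((2 * n + m) choose 2) + int (m choose 2)
      = (2 * (int n)\<^sup>2 - int n) + (int (m\<^sup>2) + (2 * int n - 1) * int m)"
    using int_choose_two[of "2 * n + m"] int_choose_two[of m]
    by (simp add: power2_eq_square algebra_simps)
  have "q ^ ((2 * n + m) choose 2) * q ^ (m choose 2)
      = q powi (int ((2 * n + m) choose 2) + int (m choose 2))"
    using assms by (simp add: power_int_add)
  also have "\<dots> = q powi (2 * (int n)\<^sup>2 - int n) * (q ^ (m\<^sup>2) * (q powi (2 * int n - 1)) ^ m)"
    unfolding exponent
    using assms by (simp only: power_int_add power_int_mult power_int_of_nat simp_thms)
  finally have powers: "q ^ ((2 * n + m) choose 2) * q ^ (m choose 2)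
      = q powi (2 * (int n)\<^sup>2 - int n) * (q ^ (m\<^sup>2) * (q powi (2 * int n - 1)) ^ m)" .
  have "double_term q z (n, m) = (q ^ ((2 * n + m) choose 2) * q ^ (m choose 2))
      * (z ^ (2 * n) * z ^ m) / (qpoch (q\<^sup>2) (q\<^sup>2) n * qpoch q q m)"
    by (simp add: double_term_def euler_coeff_def power_add mult_ac)
  also have "\<dots> = q powi (2 * (int n)\<^sup>2 - int n) * z ^ (2 * n) / qpoch (q\<^sup>2) (q\<^sup>2) n
      * (q ^ (m\<^sup>2) / qpoch q q m * (- (- (q powi (2 * int n - 1) * z))) ^ m)"
    unfolding powers by (simp add: power_mult_distrib)
  finally show ?thesis .
qed

section \<open>Summation along rows and along diagonals\<close>

lemma double_term_row:
  assumes "0 < norm q" and q: "norm q < 1"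
  shows "((\<lambda>m. double_term q z (n, m)) has_sum
    (q powi (2 * (int n)\<^sup>2 - int n) * z ^ (2 * n) / qpoch (q\<^sup>2) (q\<^sup>2) n
      * ramanujan_A q (- (q powi (2 * int n - 1) * z)))) UNIV"
    (is "(_ has_sum ?v) _")
proof -
  have "(\<lambda>m. double_term q z (n, m)) summable_on UNIV"
    using summable_on_SigmaD1[of "curry (double_term q z)" UNIV "\<lambda>_. UNIV" n]
      double_term_summable[OF q] by (simp add: curry_def)
  then have row: "((\<lambda>m. double_term q z (n, m)) has_sum (\<Sum>\<^sub>\<infinity>m. double_term q z (n, m))) UNIV"
    by simp
  have "(\<lambda>m. double_term q z (n, m)) sums ?v"
    unfolding ramanujan_A_def
  proof (subst double_term_eq_ramanujan_term)
    show "q \<noteq> 0"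
      using assms by auto
  qed (intro sums_mult summable_sums summable_ramanujan_A q)
  then have "(\<Sum>\<^sub>\<infinity>m. double_term q z (n, m)) = ?v"
    using has_sum_imp_sums[OF row] by (rule sums_unique2[symmetric])
  with row show ?thesis
    by simp
qed

lemma double_term_diagonal:
  assumes q: "norm q < 1"
  shows "(\<Sum>n\<le>k div 2. double_term q z (n, k - 2 * n)) = euler_coeff q k * z ^ k"
proof -
  have "(\<Sum>n\<le>k div 2. double_term q z (n, k - 2 * n))
      = (\<Sum>n\<le>k div 2. q ^ (k choose 2) * z ^ k
          * (euler_coeff q (k - 2 * n) / qpoch (q\<^sup>2) (q\<^sup>2) n))"
    by (rule sum.cong) (auto simp: double_term_def)
  also have "\<dots> = q ^ (k choose 2) * z ^ k * (1 / qpoch q q k)"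
    by (simp only: sum_distrib_left[symmetric] euler_coeff_convolution[OF q])
  finally show ?thesis
    by (simp add: euler_coeff_def)
qed

lemma bij_betw_diagonals:
  "bij_betw (\<lambda>(k, n). (n, k - 2 * n)) (Sigma UNIV (\<lambda>k. {..k div 2})) (UNIV \<times> (UNIV :: nat set))"
  by (rule bij_betwI[where g = "\<lambda>(n, m). (2 * n + m, n)"]) auto

theorem corollary1p3:
  fixes q z :: complex
  assumes "0 < norm q" and "norm q < 1"
  shows "(\<lambda>n. q powi (2 * (int n)\<^sup>2 - int n) * z ^ (2 * n) / qpoch (q\<^sup>2) (q\<^sup>2) n
            * ramanujan_A q (- (q powi (2 * int n - 1) * z)))
         sums qpoch_inf (- z) q"
proof -
  define S where "S = infsum (double_term q z) (UNIV \<times> UNIV)"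
  have S: "(double_term q z has_sum S) (UNIV \<times> UNIV)"
    unfolding S_def by (rule has_sum_infsum[OF double_term_summable[OF assms(2)]])
  have by_rows: "(\<lambda>n. q powi (2 * (int n)\<^sup>2 - int n) * z ^ (2 * n) / qpoch (q\<^sup>2) (q\<^sup>2) n
      * ramanujan_A q (- (q powi (2 * int n - 1) * z))) sums S"
    by (rule has_sum_imp_sums[OF has_sum_SigmaD[OF S double_term_row[OF assms]]])
  have "((\<lambda>(k, n). double_term q z (n, k - 2 * n)) has_sum S) (Sigma UNIV (\<lambda>k. {..k div 2}))"
    using S has_sum_reindex_bij_betw[OF bij_betw_diagonals, of "double_term q z" S]
    by (simp add: case_prod_unfold)
  then have "((\<lambda>k. euler_coeff q k * z ^ k) has_sum S) UNIV"
    by (rule has_sum_SigmaD) (auto intro!: has_sum_finiteI simp: double_term_diagonal[OF assms(2)])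
  then have "S = qpoch_inf (- z) q"
    using euler_series_sums[OF assms(2)] by (blast dest: has_sum_imp_sums sums_unique2)
  with by_rows show ?thesis
    by simp
qed

end
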